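(* The mapping $\Sigma:\mathcal{D}'(\mathbb{R}^d)\to{}^*\mathcal{E}(\mathbb{R}^d)$, $\Sigma(T)=\langle T*\varphi\rangle$, is injective.
   Context: Let $d\ge 1$, $\mathcal{E}(\mathbb{R}^d)=\mathcal{C}^\infty(\mathbb{R}^d)$ (smooth complex-valued functions), $\mathcal{D}(\mathbb{R}^d)=\mathcal{C}_0^\infty(\mathbb{R}^d)$ (those with compact support), and $\mathcal{D}'(\mathbb{R}^d)$ the space of Schwartz distributions. Put $\mathcal{B}_0=\mathcal{D}(\mathbb{R}^d)$ and, for $n\in\mathbb{N}=\{1,2,\dots\}$, let $\mathcal{B}_n$ be the set of all $\varphi\in\mathcal{D}(\mathbb{R}^d)$ such that: $\varphi$ is real-valued and symmetric ($\varphi(-x)=\varphi(x)$); $\varphi(x)=0$ whenever $\|x\|\ge 1/n$; $\int\varphi=1$; $\int x^\alpha\varphi(x)\,dx=0$ for all multi-indices $\alpha\in\mathbb{N}_0^d$ with $1\le|\alpha|\le n$; and $1\le\int|\varphi|<1+\frac1n$. It is known that each $\mathcal{B}_n$ is non-empty, that $\mathcal{B}_0\supset\mathcal{B}_1\supset\mathcal{B}_2\supset\cdots$, and that $\bigcap_n\mathcal{B}_n=\varnothing$. Fix an ultrafilter $\mathcal{U}$ on the set $\mathcal{D}(\mathbb{R}^d)$ containing the filter $\{\Phi\subseteq\mathcal{D}(\mathbb{R}^d): \mathcal{B}_n\subseteq\Phi\text{ for some }n\in\mathbb{N}\}$. A property holds "a.e." if the set of $\varphi$ for which it holds belongs to $\mathcal{U}$.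 ${}^*\mathcal{E}(\mathbb{R}^d)$ is the set of equivalence classes $\langle f_\varphi\rangle$ of families $(f_\varphi)\in\mathcal{E}(\mathbb{R}^d)^{\mathcal{D}(\mathbb{R}^d)}$ under the relation $(f_\varphi)\sim(g_\varphi)$ iff $f_\varphi=g_\varphi$ a.e. For $T\in\mathcal{D}'(\mathbb{R}^d)$ and $\varphi\in\mathcal{D}(\mathbb{R}^d)$, the convolution is the function $(T*\varphi)(x)=T[\varphi(x-t)]$ ($T$ acting in the variable $t$), which lies in $\mathcal{E}(\mathbb{R}^d)$. $\langle T*\varphi\rangle$ denotes the class of the family $\varphi\mapsto T*\varphi$. *)

theory Defs
  imports "HOL-Analysis.Analysis" "HOL-Library.FuncSet"
begin

section \<open>Smooth functions and test functions on \<open>\<real>\<^sup>d\<close>\<close>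

definition partial_deriv :: "'n \<Rightarrow> (real ^ 'n \<Rightarrow> complex) \<Rightarrow> real ^ 'n \<Rightarrow> complex"
  where "partial_deriv i f = (\<lambda>x. frechet_derivative f (at x) (axis i 1))"

text \<open>
  Iterated partial derivatives are indexed by the list of coordinates in which one
  differentiates. For smooth functions, the \<open>\<partial>\<^sup>\<alpha> f\<close> with \<open>\<alpha>\<close> a multi-index are exactly the
  \<open>partial_derivs is f\<close>, where \<open>\<alpha> i\<close> is the number of occurrences of \<open>i\<close> in \<open>is\<close>.
\<close>

primrec partial_derivs :: "'n list \<Rightarrow> (real ^ 'n \<Rightarrow> complex) \<Rightarrow> real ^ 'n \<Rightarrow> complex"
  where
    "partial_derivs [] f = f"
  | "partial_derivs (i # is) f = partial_deriv i (partial_derivs is f)"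

text \<open>
  \<open>\<E>(\<real>\<^sup>d)\<close>: partial derivatives of all orders exist and are (totally) differentiable,
  hence also continuous.
\<close>

definition smooth_functions :: "(real ^ 'n \<Rightarrow> complex) set"
  where "smooth_functions = {f. \<forall>is x. partial_derivs is f differentiable (at x)}"

definition test_functions :: "(real ^ 'n \<Rightarrow> complex) set"
  where "test_functions = {\<phi> \<in> smooth_functions. compact (closure {x. \<phi> x \<noteq> 0})}"


section \<open>Distributions\<close>

definition test_function_limit ::
    "(nat \<Rightarrow> real ^ 'n \<Rightarrow> complex) \<Rightarrow> (real ^ 'n \<Rightarrow> complex) \<Rightarrow> bool"
  where "test_function_limit \<phi>s \<phi> \<longleftrightarrow>
    (\<forall>k. \<phi>s k \<in> test_functions) \<and> \<phi> \<in> test_functions \<and>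
    (\<exists>K. compact K \<and> closure {x. \<phi> x \<noteq> 0} \<subseteq> K \<and> (\<forall>k. closure {x. \<phi>s k x \<noteq> 0} \<subseteq> K)) \<and>
    (\<forall>is. uniform_limit UNIV (\<lambda>k. partial_derivs is (\<phi>s k)) (partial_derivs is \<phi>) sequentially)"

text \<open>
  For linear functionals on \<open>\<D>(\<real>\<^sup>d)\<close>, continuity with respect to the usual inductive limit
  topology is the same as sequential continuity. A functional is represented by a function that is
  \<open>undefined\<close> outside \<open>\<D>(\<real>\<^sup>d)\<close>, so equality in HOL is equality of functionals.
\<close>

definition distributions :: "((real ^ 'n \<Rightarrow> complex) \<Rightarrow> complex) set"
  where "distributions = {T \<in> extensional test_functions.
    (\<forall>\<phi>\<in>test_functions. \<forall>\<psi>\<in>test_functions. T (\<lambda>x. \<phi> x + \<psi> x) = T \<phi> + T \<psi>) \<and>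
    (\<forall>c. \<forall>\<phi>\<in>test_functions. T (\<lambda>x. c * \<phi> x) = c * T \<phi>) \<and>
    (\<forall>\<phi>s \<phi>. test_function_limit \<phi>s \<phi> \<longrightarrow> (\<lambda>k. T (\<phi>s k)) \<longlonglongrightarrow> T \<phi>)}"

definition distr_convolution ::
    "((real ^ 'n \<Rightarrow> complex) \<Rightarrow> complex) \<Rightarrow> (real ^ 'n \<Rightarrow> complex) \<Rightarrow> real ^ 'n \<Rightarrow> complex"
  where "distr_convolution T \<phi> = (\<lambda>x. T (\<lambda>t. \<phi> (x - t)))"


section \<open>The directing sets \<open>\<B>\<^sub>n\<close> and the ultrafilter\<close>

definition monomial :: "('n::finite \<Rightarrow> nat) \<Rightarrow> real ^ 'n \<Rightarrow> real"
  where "monomial \<alpha> x = (\<Prod>i\<in>UNIV. (x $ i) ^ \<alpha> i)"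

definition directing_set :: "nat \<Rightarrow> (real ^ 'n \<Rightarrow> complex) set"
  where "directing_set n = (if n = 0 then test_functions else
    {\<phi> \<in> test_functions.
      (\<forall>x. \<phi> x \<in> \<real>) \<and>
      (\<forall>x. \<phi> (- x) = \<phi> x) \<and>
      (\<forall>x. norm x \<ge> 1 / real n \<longrightarrow> \<phi> x = 0) \<and>
      (LINT x|lborel. \<phi> x) = 1 \<and>
      (\<forall>\<alpha>. 1 \<le> (\<Sum>i\<in>UNIV. \<alpha> i) \<and> (\<Sum>i\<in>UNIV. \<alpha> i) \<le> n \<longrightarrow>
        (LINT x|lborel. complex_of_real (monomial \<alpha> x) * \<phi> x) = 0) \<and>
      1 \<le> (LINT x|lborel. norm (\<phi> x)) \<and> (LINT x|lborel. norm (\<phi> x)) < 1 + 1 / real n})"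

definition basic_filter_sets :: "(real ^ 'n \<Rightarrow> complex) set set"
  where "basic_filter_sets = {\<Phi>. \<Phi> \<subseteq> test_functions \<and> (\<exists>n\<ge>1. directing_set n \<subseteq> \<Phi>)}"

text \<open>
  A filter on a set \<open>A\<close> is represented by a filter on the surrounding type that contains \<open>A\<close>;
  its members are then the sets \<open>\<Phi> \<subseteq> A\<close> with \<open>eventually (\<lambda>x. x \<in> \<Phi>) F\<close>.
\<close>

definition ultrafilter_on :: "'a set \<Rightarrow> 'a filter \<Rightarrow> bool"
  where "ultrafilter_on A F \<longleftrightarrow>
    F \<le> principal A \<and> F \<noteq> bot \<and> (\<forall>P. eventually P F \<or> eventually (\<lambda>x. \<not> P x) F)"


section \<open>Generalized functions and the embedding of distributions\<close>

definition smooth_families :: "((real ^ 'n \<Rightarrow> complex) \<Rightarrow> (real ^ 'n \<Rightarrow> complex)) set"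
  where "smooth_families = test_functions \<rightarrow>\<^sub>E smooth_functions"

definition ae_equal :: "(real ^ 'n \<Rightarrow> complex) filter \<Rightarrow>
    (((real ^ 'n \<Rightarrow> complex) \<Rightarrow> (real ^ 'n \<Rightarrow> complex)) \<times>
     ((real ^ 'n \<Rightarrow> complex) \<Rightarrow> (real ^ 'n \<Rightarrow> complex))) set"
  where "ae_equal U = {(f, g). f \<in> smooth_families \<and> g \<in> smooth_families \<and>
    eventually (\<lambda>\<phi>. f \<phi> = g \<phi>) U}"

definition star_smooth :: "(real ^ 'n \<Rightarrow> complex) filter \<Rightarrow>
    ((real ^ 'n \<Rightarrow> complex) \<Rightarrow> (real ^ 'n \<Rightarrow> complex)) set set"
  where "star_smooth U = smooth_families // ae_equal U"

definition star_class :: "(real ^ 'n \<Rightarrow> complex) filter \<Rightarrow>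
    ((real ^ 'n \<Rightarrow> complex) \<Rightarrow> (real ^ 'n \<Rightarrow> complex)) \<Rightarrow>
    ((real ^ 'n \<Rightarrow> complex) \<Rightarrow> (real ^ 'n \<Rightarrow> complex)) set"
  where "star_class U f = ae_equal U `` {f}"

definition distr_embedding :: "(real ^ 'n \<Rightarrow> complex) filter \<Rightarrow>
    ((real ^ 'n \<Rightarrow> complex) \<Rightarrow> complex) \<Rightarrow>
    ((real ^ 'n \<Rightarrow> complex) \<Rightarrow> (real ^ 'n \<Rightarrow> complex)) set"
  where "distr_embedding U T =
    star_class U (restrict (\<lambda>\<phi>. distr_convolution T \<phi>) test_functions)"

end

theory Submission
  imports Defs
begin

text \<open>
  That \<open>T * \<phi>\<close> is smooth, with \<open>\<partial>\<^sup>\<alpha> (T * \<phi>) = T * \<partial>\<^sup>\<alpha> \<phi>\<close>, follows by pulling the difference quotients inside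
  \<open>T\<close>: they converge in \<open>\<D>(\<real>\<^sup>d)\<close> because first-order expansions of test functions hold uniformly
  (\<open>test_function_uniform_expansion\<close>) and partial derivatives commute (\<open>partial_deriv_commute\<close>).

  For injectivity let \<open>T * \<phi> = S * \<phi>\<close> for almost every \<open>\<phi>\<close>. Each directing set \<open>\<B>\<^sub>n\<close> belongs to the
  ultrafilter, hence contains some \<open>\<phi>\<^sub>n\<close> with \<open>T * \<phi>\<^sub>n = S * \<phi>\<^sub>n\<close>. As \<open>\<phi>\<^sub>n\<close> is symmetric, this says that \<open>T\<close>
  and \<open>S\<close> agree on all translates of \<open>\<phi>\<^sub>n\<close>. The test functions on which \<open>T\<close> and \<open>S\<close> agree form a linear
  space that is closed under limits in \<open>\<D>(\<real>\<^sup>d)\<close>. For a test function \<open>f\<close> the Riemann sums of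
  \<open>f * \<phi>\<^sub>n\<close> are linear combinations of translates of \<open>\<phi>\<^sub>n\<close> and converge to \<open>f * \<phi>\<^sub>n\<close> in \<open>\<D>(\<real>\<^sup>d)\<close>
  (\<open>convolution_limit_of_Riemann_sums\<close>), so \<open>f * \<phi>\<^sub>n\<close> lies in that space. Finally \<open>f * \<phi>\<^sub>n \<rightarrow> f\<close> in
  \<open>\<D>(\<real>\<^sup>d)\<close>, because the \<open>\<phi>\<^sub>n\<close> have integral \<open>1\<close>, bounded \<open>L\<^sup>1\<close> norms and shrinking supports
  (\<open>approximate_identity_limit\<close>); so \<open>f\<close> lies in it as well.

  The convolution of two functions is treated as the convolution with a distribution that has a
  density. All its derivatives are then given by the rule above, and commutativity allows them to fall
  on either factor: on \<open>\<phi>\<^sub>n\<close> for the Riemann sums, on \<open>f\<close> for the limit \<open>n \<rightarrow> \<infinity>\<close>.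
\<close>

section \<open>Partial derivatives of smooth functions\<close>

lemma partial_deriv_unique:
  assumes "(f has_derivative f') (at x)"
  shows "partial_deriv i f x = f' (axis i 1)"
  using frechet_derivative_at[OF assms] by (simp add: partial_deriv_def)

lemma has_derivative_partial_deriv:
  fixes f :: "real ^ 'n \<Rightarrow> complex"
  assumes "f differentiable (at x)"
  shows "(f has_derivative (\<lambda>h. \<Sum>i\<in>UNIV. (h $ i) *\<^sub>R partial_deriv i f x)) (at x)"
proof -
  let ?D = "frechet_derivative f (at x)"
  have D: "(f has_derivative ?D) (at x)"
    using assms frechet_derivative_works by blast
  then interpret linear ?D
    by (rule has_derivative_linear)
  have "?D h = (\<Sum>i\<in>UNIV. (h $ i) *\<^sub>R partial_deriv i f x)" for h
  proof -
    have "h = (\<Sum>i\<in>UNIV. (h $ i) *\<^sub>R axis i 1)"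
      using basis_expansion[of h] by (simp add: scalar_mult_eq_scaleR)
    then have "?D h = ?D (\<Sum>i\<in>UNIV. (h $ i) *\<^sub>R axis i 1)"
      by simp
    then show ?thesis
      by (simp add: sum scale partial_deriv_def)
  qed
  then show ?thesis
    by (intro has_derivative_eq_rhs[OF D] ext)
qed

lemma partial_derivs_append: "partial_derivs (is @ js) f = partial_derivs is (partial_derivs js f)"
  by (induction "is") auto

lemma smooth_functions_differentiable: "f \<in> smooth_functions \<Longrightarrow> f differentiable (at x)"
  unfolding smooth_functions_def by (auto dest: spec[of _ "[]"])

lemma smooth_functions_partial_derivs:
  "f \<in> smooth_functions \<Longrightarrow> partial_derivs is f \<in> smooth_functions"
  unfolding smooth_functions_def by (simp flip: partial_derivs_append)

lemma smooth_functions_partial_deriv: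
  "f \<in> smooth_functions \<Longrightarrow> partial_deriv i f \<in> smooth_functions"
  using smooth_functions_partial_derivs[of f "[i]"] by simp

lemma smooth_functions_has_derivative:
  "f \<in> smooth_functions \<Longrightarrow>
    (f has_derivative (\<lambda>h. \<Sum>i\<in>UNIV. (h $ i) *\<^sub>R partial_deriv i f x)) (at x)"
  by (intro has_derivative_partial_deriv smooth_functions_differentiable)

lemma partial_derivs_add:
  assumes "f \<in> smooth_functions" "g \<in> smooth_functions"
  shows "partial_derivs is (\<lambda>x. f x + g x) = (\<lambda>x. partial_derivs is f x + partial_derivs is g x)"
proof (induction "is")
  case (Cons i "is")
  let ?f = "partial_derivs is f" and ?g = "partial_derivs is g"
  have "partial_deriv i (\<lambda>x. ?f x + ?g x) x = partial_deriv i ?f x + partial_deriv i ?g x" for x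
  proof -
    have "?f differentiable (at x)" "?g differentiable (at x)"
      using assms by (auto intro: smooth_functions_differentiable smooth_functions_partial_derivs)
    then have "((\<lambda>x. ?f x + ?g x) has_derivative
        (\<lambda>h. frechet_derivative ?f (at x) h + frechet_derivative ?g (at x) h)) (at x)"
      by (intro has_derivative_add iffD1[OF frechet_derivative_works])
    from partial_deriv_unique[OF this] show ?thesis
      by (simp add: partial_deriv_def)
  qed
  with Cons show ?case by auto
qed auto

lemma smooth_functions_add:
  assumes "f \<in> smooth_functions" "g \<in> smooth_functions"
  shows "(\<lambda>x. f x + g x) \<in> smooth_functions"
  using assms by (auto simp: smooth_functions_def partial_derivs_add intro!: differentiable_add)

lemma partial_derivs_scale:
  assumes "f \<in> smooth_functions"
  shows "partial_derivs is (\<lambda>x. c * f x) = (\<lambda>x. c * partial_derivs is f x)"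
proof (induction "is")
  case (Cons i "is")
  let ?f = "partial_derivs is f"
  have "partial_deriv i (\<lambda>x. c * ?f x) x = c * partial_deriv i ?f x" for x
  proof -
    have "?f differentiable (at x)"
      using assms by (auto intro: smooth_functions_differentiable smooth_functions_partial_derivs)
    then have "((\<lambda>x. c * ?f x) has_derivative (\<lambda>h. c * frechet_derivative ?f (at x) h)) (at x)"
      by (intro has_derivative_mult_right iffD1[OF frechet_derivative_works])
    from partial_deriv_unique[OF this] show ?thesis
      by (simp add: partial_deriv_def)
  qed
  with Cons show ?case by auto
qed auto

lemma smooth_functions_scale:
  assumes "f \<in> smooth_functions"
  shows "(\<lambda>x. c * f x) \<in> smooth_functions"
  using assms by (auto simp: smooth_functions_def partial_derivs_scale intro!: differentiable_mult)

lemma partial_derivs_zero: "partial_derivs is (\<lambda>x. 0) = (\<lambda>x. 0)"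
  by (induction "is") (auto simp: partial_deriv_def)

lemma smooth_functions_zero: "(\<lambda>x. 0) \<in> smooth_functions"
  by (simp add: smooth_functions_def partial_derivs_zero)

lemma smooth_functions_sum:
  assumes "\<And>p. p \<in> P \<Longrightarrow> f p \<in> smooth_functions"
  shows "(\<lambda>x. \<Sum>p\<in>P. f p x) \<in> smooth_functions"
  using assms
  by (induction P rule: infinite_finite_induct) (auto intro: smooth_functions_add smooth_functions_zero)

lemma partial_derivs_sum:
  assumes "\<And>p. p \<in> P \<Longrightarrow> f p \<in> smooth_functions"
  shows "partial_derivs is (\<lambda>x. \<Sum>p\<in>P. f p x) = (\<lambda>x. \<Sum>p\<in>P. partial_derivs is (f p) x)"
  using assms
  by (induction P rule: infinite_finite_induct)
    (auto simp: partial_derivs_add smooth_functions_sum partial_derivs_zero)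

text \<open>
  Keeping the factor \<open>s\<close> general treats translations (\<open>s = 1\<close>) and reflections (\<open>s = -1\<close>) at once.
\<close>

lemma partial_derivs_affine:
  fixes s :: real
  assumes "f \<in> smooth_functions"
  shows "partial_derivs is (\<lambda>t. f (x + s *\<^sub>R t)) =
    (\<lambda>t. of_real s ^ length is * partial_derivs is f (x + s *\<^sub>R t))"
proof (induction "is")
  case (Cons i "is")
  let ?f = "partial_derivs is f" and ?c = "of_real s ^ length is"
  have "partial_deriv i (\<lambda>t. ?c * ?f (x + s *\<^sub>R t)) t = ?c * (s * partial_deriv i ?f (x + s *\<^sub>R t))" for t
  proof -
    have D: "(?f has_derivative frechet_derivative ?f (at (x + s *\<^sub>R t))) (at (x + s *\<^sub>R t))"
      using assms by (intro iffD1[OF frechet_derivative_works] smooth_functions_differentiable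
          smooth_functions_partial_derivs)
    then interpret linear "frechet_derivative ?f (at (x + s *\<^sub>R t))"
      by (rule has_derivative_linear)
    have "((\<lambda>t. x + s *\<^sub>R t) has_derivative (\<lambda>h. s *\<^sub>R h)) (at t)"
      by (auto intro!: derivative_eq_intros)
    from partial_deriv_unique[OF has_derivative_mult_right[OF has_derivative_compose[OF this D]]]
    show ?thesis
      by (simp add: partial_deriv_def scale scaleR_conv_of_real[where 'a = complex])
  qed
  with Cons show ?case by (auto simp: mult_ac)
qed auto

lemma smooth_functions_affine:
  fixes s :: real
  assumes "f \<in> smooth_functions"
  shows "(\<lambda>t. f (x + s *\<^sub>R t)) \<in> smooth_functions"
proof -
  have "(\<lambda>t. partial_derivs is f (x + s *\<^sub>R t)) differentiable (at t)" for t "is"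
  proof -
    have "(\<lambda>t. x + s *\<^sub>R t) differentiable (at t)"
      by (intro differentiable_add differentiable_scaleR) auto
    moreover have "partial_derivs is f differentiable at (x + s *\<^sub>R t)"
      using assms by (intro smooth_functions_differentiable smooth_functions_partial_derivs)
    ultimately show ?thesis
      using differentiable_chain_at[of "\<lambda>t. x + s *\<^sub>R t" t "partial_derivs is f"] by (simp add: o_def)
  qed
  then show ?thesis
    using assms by (auto simp: smooth_functions_def partial_derivs_affine intro!: differentiable_mult)
qed

section \<open>Test functions\<close>

lemma test_functions_smooth: "f \<in> test_functions \<Longrightarrow> f \<in> smooth_functions"
  by (simp add: test_functions_def)

lemma closure_support_subset:
  assumes "closed K" "\<And>x. x \<notin> K \<Longrightarrow> f x = 0"
  shows "closure {x. f x \<noteq> 0} \<subseteq> K"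
  using assms by (intro closure_minimal) auto

text \<open>
  Vanishing outside some ball is easier to propagate through the constructions below than
  compactness of the closed support.
\<close>

lemma test_functions_iff:
  "f \<in> test_functions \<longleftrightarrow> f \<in> smooth_functions \<and> (\<exists>r. \<forall>x. r < norm x \<longrightarrow> f x = 0)"
proof safe
  assume f: "f \<in> test_functions"
  then show "f \<in> smooth_functions"
    by (rule test_functions_smooth)
  have "bounded (closure {x. f x \<noteq> 0})"
    using f by (simp add: test_functions_def compact_imp_bounded)
  then obtain r where "\<forall>x\<in>closure {x. f x \<noteq> 0}. norm x \<le> r"
    unfolding bounded_iff by blast
  then show "\<exists>r. \<forall>x. r < norm x \<longrightarrow> f x = 0"
    using closure_subset[of "{x. f x \<noteq> 0}"] by (intro exI[of _ r]) force
next
  fix r assume f: "f \<in> smooth_functions" and r: "\<forall>x. r < norm x \<longrightarrow> f x = 0"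
  have "closure {x. f x \<noteq> 0} \<subseteq> cball 0 r"
    using r by (intro closure_support_subset) auto
  then have "compact (closure {x. f x \<noteq> 0})"
    by (metis bounded_cball bounded_subset closed_closure compact_eq_bounded_closed)
  with f show "f \<in> test_functions"
    by (simp add: test_functions_def)
qed

lemma test_function_supportE:
  assumes "f \<in> test_functions"
  obtains r where "0 \<le> r" "\<And>x. r < norm x \<Longrightarrow> f x = 0"
proof -
  obtain r where "\<forall>x. r < norm x \<longrightarrow> f x = 0"
    using assms test_functions_iff by blast
  then show ?thesis
    by (intro that[of "max r 0"]) auto
qed

lemma partial_deriv_vanishing:
  assumes r: "\<And>x. r < norm x \<Longrightarrow> f x = 0" and x: "r < norm x"
  shows "partial_deriv i f x = 0"
proof -
  have "open {x. r < norm x}"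
    by (intro open_Collect_less continuous_intros)
  then have "(f has_derivative (\<lambda>h. 0)) (at x)"
    using x r by (intro has_derivative_transform_within_open[OF has_derivative_const[of 0]]) auto
  from partial_deriv_unique[OF this] show ?thesis
    by simp
qed

lemma test_functions_partial_deriv:
  assumes "f \<in> test_functions"
  shows "partial_deriv i f \<in> test_functions"
  using assms smooth_functions_partial_deriv partial_deriv_vanishing
  unfolding test_functions_iff by metis

lemma test_functions_partial_derivs:
  "f \<in> test_functions \<Longrightarrow> partial_derivs is f \<in> test_functions"
  by (induction "is") (auto intro: test_functions_partial_deriv)

lemma test_functions_add:
  assumes "f \<in> test_functions" "g \<in> test_functions"
  shows "(\<lambda>x. f x + g x) \<in> test_functions"
proof -
  obtain r r' where "\<And>x. r < norm x \<Longrightarrow> f x = 0" "\<And>x. r' < norm x \<Longrightarrow> g x = 0"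
    using assms by (metis test_function_supportE)
  then have "\<forall>x. max r r' < norm x \<longrightarrow> f x + g x = 0"
    by simp
  then show ?thesis
    using assms unfolding test_functions_iff by (blast intro: smooth_functions_add)
qed

lemma test_functions_scale:
  assumes "f \<in> test_functions"
  shows "(\<lambda>x. c * f x) \<in> test_functions"
  using assms by (auto simp: test_functions_iff intro: smooth_functions_scale)

lemma test_functions_zero: "(\<lambda>x. 0) \<in> test_functions"
  by (simp add: test_functions_iff smooth_functions_zero)

lemma test_functions_sum:
  assumes "\<And>p. p \<in> P \<Longrightarrow> f p \<in> test_functions"
  shows "(\<lambda>x. \<Sum>p\<in>P. f p x) \<in> test_functions"
  using assms
  by (induction P rule: infinite_finite_induct) (auto intro: test_functions_add test_functions_zero)

lemma test_functions_affine:
  fixes s :: real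
  assumes f: "f \<in> test_functions" and s: "s \<noteq> 0"
  shows "(\<lambda>t. f (x + s *\<^sub>R t)) \<in> test_functions"
proof -
  obtain r where r: "\<And>x. r < norm x \<Longrightarrow> f x = 0"
    using test_function_supportE[OF f] by blast
  have "f (x + s *\<^sub>R t) = 0" if "(r + norm x) / \<bar>s\<bar> < norm t" for t
  proof (rule r)
    have "r + norm x < norm (s *\<^sub>R t)"
      using that s by (simp add: divide_less_eq mult.commute)
    also have "\<dots> \<le> norm (x + s *\<^sub>R t) + norm x"
      using norm_triangle_ineq4[of "x + s *\<^sub>R t" x] by simp
    finally show "r < norm (x + s *\<^sub>R t)" by simp
  qed
  then show ?thesis
    using f unfolding test_functions_iff by (blast intro: smooth_functions_affine)
qed

lemma test_functions_translate: "f \<in> test_functions \<Longrightarrow> (\<lambda>t. f (t + h)) \<in> test_functions"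
  using test_functions_affine[of f 1 h] by (simp add: add.commute)

lemma test_functions_reflect: "f \<in> test_functions \<Longrightarrow> (\<lambda>t. f (x - t)) \<in> test_functions"
  using test_functions_affine[of f "-1" x] by simp

lemma partial_derivs_translate:
  "f \<in> smooth_functions \<Longrightarrow> partial_derivs is (\<lambda>t. f (t + h)) = (\<lambda>t. partial_derivs is f (t + h))"
  using partial_derivs_affine[of f "is" h 1] by (simp add: add.commute)

lemma partial_derivs_reflect:
  "f \<in> smooth_functions \<Longrightarrow>
    partial_derivs is (\<lambda>t. f (x - t)) = (\<lambda>t. (-1) ^ length is * partial_derivs is f (x - t))"
  using partial_derivs_affine[of f "is" x "-1"] by simp

lemma test_function_limitI:
  assumes "\<And>k. f k \<in> test_functions" "g \<in> test_functions"
    and "\<And>k x. r < norm x \<Longrightarrow> f k x = 0" "\<And>x. r < norm x \<Longrightarrow> g x = 0"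
    and "\<And>is. uniform_limit UNIV (\<lambda>k. partial_derivs is (f k)) (partial_derivs is g) sequentially"
  shows "test_function_limit f g"
proof -
  have "closure {x. g x \<noteq> 0} \<subseteq> cball 0 r" "closure {x. f k x \<noteq> 0} \<subseteq> cball 0 r" for k
    by (rule closure_support_subset; use assms in auto)+
  then show ?thesis
    using assms unfolding test_function_limit_def by (auto intro!: exI[of _ "cball 0 r"])
qed

lemma test_functions_continuous_on: "f \<in> test_functions \<Longrightarrow> continuous_on A f"
  by (intro continuous_at_imp_continuous_on ballI differentiable_imp_continuous_within
      smooth_functions_differentiable test_functions_smooth)

lemma uniformly_continuous_on_vanishing:
  fixes f :: "'a :: euclidean_space \<Rightarrow> 'b :: real_normed_vector"
  assumes cont: "continuous_on UNIV f" and r: "\<And>x. r < norm x \<Longrightarrow> f x = 0"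
  shows "uniformly_continuous_on UNIV f"
  unfolding uniformly_continuous_on_def
proof (intro allI impI)
  fix e :: real assume e: "0 < e"
  have "uniformly_continuous_on (cball 0 (r + 1)) f"
    using cont by (intro compact_uniformly_continuous continuous_on_subset[OF cont]) auto
  with e obtain d where d: "d > 0" and
    D: "\<And>x y. \<lbrakk>norm x \<le> r + 1; norm y \<le> r + 1; dist y x < d\<rbrakk> \<Longrightarrow> dist (f y) (f x) < e"
    unfolding uniformly_continuous_on_def by (metis mem_cball_0)
  have "dist (f y) (f x) < e" if "dist y x < min d 1" for x y
  proof (cases "norm x \<le> r + 1 \<and> norm y \<le> r + 1")
    case False
    have "norm x \<le> norm y + dist y x" "norm y \<le> norm x + dist y x"
      using norm_triangle_sub[of x y] norm_triangle_sub[of y x] by (auto simp: dist_norm norm_minus_commute)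
    with that False have "r < norm x" "r < norm y" by auto
    then show ?thesis using r e by simp
  qed (use D that in auto)
  with d show "\<exists>d>0. \<forall>x\<in>UNIV. \<forall>x'\<in>UNIV. dist x' x < d \<longrightarrow> dist (f x') (f x) < e"
    by (intro exI[of _ "min d 1"]) auto
qed

lemma test_function_uniformly_continuous:
  assumes f: "f \<in> test_functions" and e: "0 < e"
  obtains d where "0 < d" "\<And>x y. norm (y - x) < d \<Longrightarrow> norm (f y - f x) < e"
proof -
  obtain r where "\<And>x. r < norm x \<Longrightarrow> f x = 0"
    using test_function_supportE[OF f] by blast
  then have "uniformly_continuous_on UNIV f"
    by (intro uniformly_continuous_on_vanishing test_functions_continuous_on[OF f])
  with e that show ?thesis
    unfolding uniformly_continuous_on_def dist_norm by (metis UNIV_I)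
qed

lemma integrable_test_function_mult:
  assumes f: "f \<in> test_functions" and g: "continuous_on UNIV g"
  shows "integrable lborel (\<lambda>x. f x * g x :: complex)"
proof -
  obtain r where r: "\<And>x. r < norm x \<Longrightarrow> f x = 0"
    using test_function_supportE[OF f] by blast
  have "integrable lborel (\<lambda>x. indicator (cball 0 r) x *\<^sub>R (f x * g x))"
    by (intro borel_integrable_compact continuous_on_mult test_functions_continuous_on f
        continuous_on_subset[OF g]) auto
  also have "(\<lambda>x. indicator (cball 0 r) x *\<^sub>R (f x * g x)) = (\<lambda>x. f x * g x)"
    using r by (auto simp: indicator_def fun_eq_iff)
  finally show ?thesis .
qed

lemma integrable_test_function: "f \<in> test_functions \<Longrightarrow> integrable lborel f"
  using integrable_test_function_mult[of f "\<lambda>x. 1"] by simp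

section \<open>Uniform first-order expansion\<close>

text \<open>
  The partial derivatives of \<open>f\<close> are uniformly continuous, so the derivative of \<open>f\<close> varies by at
  most \<open>e\<close> in operator norm over balls of a fixed small radius; the mean value inequality turns this
  into an error bound that is uniform in the base point. This uniformity is what convergence in
  \<open>\<D>(\<real>\<^sup>d)\<close> demands.
\<close>

lemma test_function_uniform_expansion:
  fixes f :: "real ^ 'n \<Rightarrow> complex"
  assumes f: "f \<in> test_functions" and e: "0 < e"
  obtains d where "0 < d" "\<And>h x. norm h < d \<Longrightarrow>
    norm (f (x + h) - f x - (\<Sum>i\<in>UNIV. (h $ i) *\<^sub>R partial_deriv i f x)) \<le> e * norm h"
proof -
  define e' where "e' = e / real CARD('n)"
  have e': "e' > 0" using e by (simp add: e'_def)
  have "\<exists>d>0. \<forall>x y. norm (y - x) < d \<longrightarrow> norm (partial_deriv i f y - partial_deriv i f x) < e'" for i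
    using test_function_uniformly_continuous[OF test_functions_partial_deriv[OF f] e'] by metis
  then obtain d where d: "\<And>i. d i > 0" and
    D: "\<And>i x y. norm (y - x) < d i \<Longrightarrow> norm (partial_deriv i f y - partial_deriv i f x) < e'"
    by metis
  define \<delta> where "\<delta> = Min (range d)"
  have \<delta>: "\<delta> > 0" "\<And>i. \<delta> \<le> d i"
    using d by (auto simp: \<delta>_def)
  let ?D = "\<lambda>x h. \<Sum>i\<in>UNIV. (h $ i) *\<^sub>R partial_deriv i f x"
  have "norm (f (x + h) - f x - ?D x h) \<le> e * norm h" if h: "norm h < \<delta>" for x h
  proof -
    have "norm (f (x + h) - f x - ?D x ((x + h) - x)) \<le> norm ((x + h) - x) * e"
    proof (rule differentiable_bound_linearization[where S = "ball x \<delta>" and f' = ?D])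
      fix t :: real assume t: "t \<in> {0..1}"
      have "norm (t *\<^sub>R h) \<le> norm h"
        using t by (simp add: mult_left_le_one_le)
      with h show "x + t *\<^sub>R (x + h - x) \<in> ball x \<delta>"
        by (simp add: dist_norm)
    next
      fix y assume y: "y \<in> ball x \<delta>"
      show "(f has_derivative ?D y) (at y within ball x \<delta>)"
        by (rule has_derivative_at_withinI[OF smooth_functions_has_derivative[OF test_functions_smooth[OF f]]])
      show "onorm (?D y - ?D x) \<le> e"
      proof (rule onorm_le)
        fix v :: "real ^ 'n"
        have "norm ((?D y - ?D x) v) = norm (\<Sum>i\<in>UNIV. (v $ i) *\<^sub>R (partial_deriv i f y - partial_deriv i f x))"
          by (simp add: sum_subtractf scaleR_diff_right)
        also have "\<dots> \<le> (\<Sum>i\<in>(UNIV :: 'n set). norm v * e')"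
        proof (rule order_trans[OF norm_sum sum_mono])
          fix i :: 'n
          have "norm (y - x) < d i"
            using y \<delta>(2)[of i] by (simp add: dist_norm norm_minus_commute)
          from D[OF this] show "norm ((v $ i) *\<^sub>R (partial_deriv i f y - partial_deriv i f x)) \<le> norm v * e'"
            using component_le_norm_cart[of v i] by (auto intro!: mult_mono)
        qed
        also have "\<dots> = e * norm v"
          by (simp add: e'_def)
        finally show "norm ((?D y - ?D x) v) \<le> e * norm v" .
      qed
    qed (use \<delta> in auto)
    then show ?thesis
      by (simp add: mult.commute)
  qed
  with \<delta>(1) show ?thesis
    by (rule that)
qed

section \<open>Commuting partial derivatives\<close>

lemma difference_quotient_uniform:
  assumes f: "f \<in> test_functions" and e: "0 < e"
  shows "\<forall>\<^sub>F n in sequentially. \<forall>y.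
    norm (real (Suc n) *\<^sub>R (f (y + inverse (real (Suc n)) *\<^sub>R axis j 1) - f y) - partial_deriv j f y) \<le> e"
proof -
  obtain d where d: "0 < d" and D: "\<And>h x. norm h < d \<Longrightarrow>
      norm (f (x + h) - f x - (\<Sum>i\<in>UNIV. (h $ i) *\<^sub>R partial_deriv i f x)) \<le> e * norm h"
    using test_function_uniform_expansion[OF f e] by blast
  have "\<forall>\<^sub>F n in sequentially. inverse (real (Suc n)) < d"
    using LIMSEQ_inverse_real_of_nat d by (rule order_tendstoD)
  then show ?thesis
  proof eventually_elim
    case (elim n)
    show ?case
    proof
      fix y
      define c where "c = inverse (real (Suc n))"
      let ?h = "c *\<^sub>R axis j (1 :: real)"
      have c: "c > 0" "real (Suc n) = inverse c" by (auto simp: c_def)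
      have sum: "(\<Sum>i\<in>UNIV. (?h $ i) *\<^sub>R partial_deriv i f y) = c *\<^sub>R partial_deriv j f y"
      proof -
        have "(?h $ i) *\<^sub>R partial_deriv i f y = (if i = j then c *\<^sub>R partial_deriv j f y else 0)" for i
          by (auto simp: axis_def)
        then show ?thesis by simp
      qed
      have h: "norm ?h = c" using c(1) by simp
      then have "norm ?h < d" using elim by (simp only: c_def)
      from D[OF this, of y] have *: "norm (f (y + ?h) - f y - c *\<^sub>R partial_deriv j f y) \<le> e * c"
        by (simp only: sum h)
      have "inverse c *\<^sub>R (f (y + ?h) - f y) - partial_deriv j f y =
          inverse c *\<^sub>R (f (y + ?h) - f y - c *\<^sub>R partial_deriv j f y)"
        using c(1) by (simp add: scaleR_diff_right)
      then have "norm (inverse c *\<^sub>R (f (y + ?h) - f y) - partial_deriv j f y) =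
          inverse c * norm (f (y + ?h) - f y - c *\<^sub>R partial_deriv j f y)"
        using c(1) by simp
      also have "\<dots> \<le> inverse c * (e * c)"
        using c(1) * by (intro mult_left_mono) auto
      also have "\<dots> = e" using c(1) by simp
      finally show "norm (real (Suc n) *\<^sub>R
          (f (y + inverse (real (Suc n)) *\<^sub>R axis j 1) - f y) - partial_deriv j f y) \<le> e"
        unfolding c(2) by simp
    qed
  qed
qed

text \<open>
  The difference quotients \<open>Q n f\<close> of \<open>f\<close> in direction \<open>j\<close> converge to \<open>\<partial>\<^sub>j f\<close>, and \<open>Q n\<close> commutes with
  \<open>\<partial>\<^sub>k\<close>. Hence their derivatives have the coordinates \<open>Q n (\<partial>\<^sub>k f)\<close>, which converge uniformly to
  \<open>\<partial>\<^sub>j \<partial>\<^sub>k f\<close>. Limit and derivative may be interchanged, so \<open>\<partial>\<^sub>j f\<close> has the partial derivatives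
  \<open>\<partial>\<^sub>j \<partial>\<^sub>k f\<close>.
\<close>

lemma partial_deriv_commute:
  fixes f :: "real ^ 'n \<Rightarrow> complex"
  assumes f: "f \<in> test_functions"
  shows "partial_deriv i (partial_deriv j f) = partial_deriv j (partial_deriv i f)"
proof
  fix x :: "real ^ 'n"
  define Q where "Q = (\<lambda>n g (y :: real ^ 'n). real (Suc n) *\<^sub>R
    (g (y + inverse (real (Suc n)) *\<^sub>R axis j 1) - g y :: complex))"
  have Q: "\<forall>\<^sub>F n in sequentially. \<forall>y. norm (Q n g y - partial_deriv j g y) \<le> e"
    if "g \<in> test_functions" "e > 0" for g :: "real ^ 'n \<Rightarrow> complex" and e
    unfolding Q_def using that by (rule difference_quotient_uniform)
  have lim: "(\<lambda>n. Q n f y) \<longlonglongrightarrow> partial_deriv j f y" for y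
  proof (rule tendstoI)
    fix e :: real assume e: "e > 0"
    then have "\<forall>\<^sub>F n in sequentially. \<forall>y. norm (Q n f y - partial_deriv j f y) \<le> e / 2"
      by (intro Q f) simp
    then show "\<forall>\<^sub>F n in sequentially. dist (Q n f y) (partial_deriv j f y) < e"
    proof eventually_elim
      case (elim n)
      then have "norm (Q n f y - partial_deriv j f y) \<le> e / 2" by blast
      then show ?case using e by (simp add: dist_norm)
    qed
  qed
  have der: "(Q n f has_derivative (\<lambda>h. \<Sum>k\<in>UNIV. (h $ k) *\<^sub>R Q n (partial_deriv k f) y)) (at y within UNIV)" for n y
  proof -
    let ?a = "inverse (real (Suc n)) *\<^sub>R axis j 1 :: real ^ 'n"
    have 1: "(f has_derivative (\<lambda>h. \<Sum>k\<in>UNIV. (h $ k) *\<^sub>R partial_deriv k f z)) (at z)" for z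
      by (intro smooth_functions_has_derivative test_functions_smooth f)
    have "((\<lambda>z. z + ?a) has_derivative (\<lambda>h. h)) (at y)"
      by (auto intro!: derivative_eq_intros)
    from has_derivative_compose[OF this 1]
    have "((\<lambda>z. f (z + ?a)) has_derivative (\<lambda>h. \<Sum>k\<in>UNIV. (h $ k) *\<^sub>R partial_deriv k f (y + ?a))) (at y)" .
    from has_derivative_scaleR_right[OF has_derivative_diff[OF this 1], of "real (Suc n)"]
    show ?thesis unfolding Q_def
      by (rule has_derivative_eq_rhs)
        (simp add: sum_subtractf[symmetric] scaleR_diff_right scaleR_sum_right mult.commute del: of_nat_Suc)
  qed
  have conv: "\<forall>\<^sub>F n in sequentially. \<forall>y\<in>UNIV. \<forall>h. norm ((\<Sum>k\<in>UNIV. (h $ k) *\<^sub>R Q n (partial_deriv k f) y) -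
      (\<Sum>k\<in>UNIV. (h $ k) *\<^sub>R partial_deriv j (partial_deriv k f) y)) \<le> e * norm h" if e: "e > 0" for e
  proof -
    have "\<forall>\<^sub>F n in sequentially. \<forall>k\<in>UNIV. \<forall>y. norm (Q n (partial_deriv k f) y - partial_deriv j (partial_deriv k f) y)
        \<le> e / real CARD('n)"
      using e by (intro eventually_ball_finite finite ballI Q test_functions_partial_deriv f) auto
    then show ?thesis
    proof eventually_elim
      case (elim n)
      show ?case
      proof (intro ballI allI)
        fix y h :: "real ^ 'n"
        have "norm ((\<Sum>k\<in>UNIV. (h $ k) *\<^sub>R Q n (partial_deriv k f) y) -
            (\<Sum>k\<in>UNIV. (h $ k) *\<^sub>R partial_deriv j (partial_deriv k f) y)) =
            norm (\<Sum>k\<in>UNIV. (h $ k) *\<^sub>R (Q n (partial_deriv k f) y - partial_deriv j (partial_deriv k f) y))"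
          by (simp add: sum_subtractf scaleR_diff_right)
        also have "\<dots> \<le> (\<Sum>k\<in>(UNIV :: 'n set). norm h * (e / real CARD('n)))"
        proof (rule sum_norm_le)
          fix k
          show "norm ((h $ k) *\<^sub>R (Q n (partial_deriv k f) y - partial_deriv j (partial_deriv k f) y))
              \<le> norm h * (e / real CARD('n))"
            unfolding norm_scaleR
            using elim component_le_norm_cart[of h k] by (intro mult_mono) auto
        qed
        also have "\<dots> = e * norm h" by simp
        finally show "norm ((\<Sum>k\<in>UNIV. (h $ k) *\<^sub>R Q n (partial_deriv k f) y) -
            (\<Sum>k\<in>UNIV. (h $ k) *\<^sub>R partial_deriv j (partial_deriv k f) y)) \<le> e * norm h" .
      qed
    qed
  qed
  obtain g where g: "\<And>y. (\<lambda>n. Q n f y) \<longlonglongrightarrow> g y"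
    "\<And>y. (g has_derivative (\<lambda>h. \<Sum>k\<in>UNIV. (h $ k) *\<^sub>R partial_deriv j (partial_deriv k f) y)) (at y)"
    using has_derivative_sequence[OF convex_UNIV der conv UNIV_I lim[of 0]] by auto
  have "g = partial_deriv j f"
    using g(1) lim LIMSEQ_unique by blast
  from partial_deriv_unique[OF g(2)[of x], of i, unfolded this]
  have "partial_deriv i (partial_deriv j f) x =
      (\<Sum>k\<in>UNIV. (axis i 1 $ k) *\<^sub>R partial_deriv j (partial_deriv k f) x)" .
  also have "\<dots> = (\<Sum>k\<in>UNIV. if k = i then partial_deriv j (partial_deriv i f) x else 0)"
    by (intro sum.cong) (auto simp: axis_def)
  finally show "partial_deriv i (partial_deriv j f) x = partial_deriv j (partial_deriv i f) x"
    by simp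
qed

lemma partial_derivs_partial_deriv_commute:
  assumes "f \<in> test_functions"
  shows "partial_derivs is (partial_deriv i f) = partial_deriv i (partial_derivs is f)"
  using assms
  by (induction "is") (auto simp: partial_deriv_commute test_functions_partial_derivs)

section \<open>Convolution with a distribution\<close>

lemma distribution_add:
  "\<lbrakk>T \<in> distributions; f \<in> test_functions; g \<in> test_functions\<rbrakk> \<Longrightarrow> T (\<lambda>x. f x + g x) = T f + T g"
  by (simp add: distributions_def)

lemma distribution_scale:
  "\<lbrakk>T \<in> distributions; f \<in> test_functions\<rbrakk> \<Longrightarrow> T (\<lambda>x. c * f x) = c * T f"
  by (simp add: distributions_def)

lemma distribution_tendsto:
  "\<lbrakk>T \<in> distributions; test_function_limit fs f\<rbrakk> \<Longrightarrow> (\<lambda>k. T (fs k)) \<longlonglongrightarrow> T f"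
  by (simp add: distributions_def)

lemma distribution_zero: "T \<in> distributions \<Longrightarrow> T (\<lambda>x. 0) = 0"
  using distribution_scale[of T "\<lambda>x. 0" 0] by (simp add: test_functions_zero)

lemma distribution_sum:
  assumes "T \<in> distributions" "\<And>p. p \<in> P \<Longrightarrow> f p \<in> test_functions"
  shows "T (\<lambda>x. \<Sum>p\<in>P. f p x) = (\<Sum>p\<in>P. T (f p))"
  using assms(2)
  by (induction P rule: infinite_finite_induct)
    (auto simp: distribution_add[OF assms(1)] distribution_zero[OF assms(1)] test_functions_sum)

text \<open>
  Continuity of \<open>T\<close> reduces the claim to the convergence in \<open>\<D>(\<real>\<^sup>d)\<close>, as \<open>h \<rightarrow> 0\<close>, of the quotients
  \<open>q h = (f(\<cdot> + h) - f - \<Sum>\<^sub>i h\<^sub>i \<partial>\<^sub>i f) / \<bar>h\<bar>\<close>, reflected at \<open>x\<close>, to \<open>0\<close>. Since partial derivatives commute,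
  \<open>\<partial>\<^sup>\<alpha> (q h)\<close> is the same quotient formed with \<open>\<partial>\<^sup>\<alpha> f\<close>, and the uniform expansion applies to it.
\<close>

lemma distr_convolution_has_derivative:
  fixes T :: "(real ^ 'n \<Rightarrow> complex) \<Rightarrow> complex"
  assumes T: "T \<in> distributions" and f: "f \<in> test_functions"
  shows "(distr_convolution T f has_derivative
    (\<lambda>h. \<Sum>i\<in>UNIV. (h $ i) *\<^sub>R distr_convolution T (partial_deriv i f) x)) (at x)"
  unfolding has_derivative_at
proof
  let ?D = "\<lambda>h. \<Sum>i\<in>UNIV. (h $ i) *\<^sub>R distr_convolution T (partial_deriv i f) x"
  show "bounded_linear ?D"
    by (intro bounded_linear_intros bounded_linear_vec_nth)
  \<comment> \<open>Only sums and multiples occur in \<open>R\<close>, so that linearity of \<open>T\<close> and the closure properties apply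
    to it directly.\<close>
  define R where "R = (\<lambda>g (h :: real ^ 'n) y.
    (g (y + h) + (-1) * g y) + (-1) * (\<Sum>i\<in>UNIV. of_real (h $ i) * partial_deriv i g y) :: complex)"
  define q where "q = (\<lambda>h y. of_real (inverse (norm h)) * R f h y)"
  note closure = test_functions_add test_functions_scale test_functions_sum test_functions_translate
    test_functions_partial_deriv test_functions_partial_derivs test_functions_reflect
    smooth_functions_add smooth_functions_scale smooth_functions_sum test_functions_smooth
  have R_test: "R g h \<in> test_functions" if "g \<in> test_functions" for g h
    unfolding R_def using that by (intro closure)
  have q_test: "q h \<in> test_functions" for h
    unfolding q_def using f by (intro closure R_test)
  \<comment> \<open>This is where partial derivatives have to commute.\<close>
  have R_deriv: "partial_derivs is (R f h) = R (partial_derivs is f) h" for h "is"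
    unfolding R_def
    by (subst partial_derivs_add partial_derivs_scale partial_derivs_sum partial_derivs_translate,
        (intro closure f)+)+
      (simp add: partial_derivs_scale partial_derivs_partial_deriv_commute f closure)
  have q_deriv: "partial_derivs is (q h) = (\<lambda>y. of_real (inverse (norm h)) * R (partial_derivs is f) h y)" for h "is"
    unfolding q_def by (subst partial_derivs_scale) (auto simp: R_deriv intro: R_test f test_functions_smooth)
  have q_small: "\<exists>d>0. \<forall>h. norm h < d \<longrightarrow> (\<forall>y. norm (partial_derivs is (q h) y) \<le> e)" if e: "e > 0" for e "is"
  proof -
    obtain d where d: "0 < d" and D: "\<And>h x. norm h < d \<Longrightarrow> norm (partial_derivs is f (x + h) - partial_derivs is f x
        - (\<Sum>i\<in>UNIV. (h $ i) *\<^sub>R partial_deriv i (partial_derivs is f) x)) \<le> e * norm h"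
      using test_function_uniform_expansion[OF test_functions_partial_derivs[OF f] e] by blast
    have "norm (partial_derivs is (q h) y) \<le> e" if "norm h < d" for h y
    proof (cases "h = 0")
      case False
      have "norm (partial_derivs is (q h) y) = inverse (norm h) * norm (R (partial_derivs is f) h y)"
        by (simp add: q_deriv norm_mult norm_inverse)
      also have "\<dots> \<le> inverse (norm h) * (e * norm h)"
        using D[OF that, of y] by (intro mult_left_mono) (auto simp: R_def scaleR_conv_of_real)
      also have "\<dots> = e"
        using False by simp
      finally show ?thesis .
    qed (use e in \<open>simp add: q_deriv\<close>)
    with d show ?thesis by blast
  qed
  have Tq: "T (\<lambda>t. q h (x - t)) = of_real (inverse (norm h)) *
      (distr_convolution T f (x + h) - distr_convolution T f x - ?D h)" for h
  proof -
    have "T (\<lambda>t. q h (x - t)) = of_real (inverse (norm h)) * T (\<lambda>t. R f h (x - t))"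
      unfolding q_def using f by (intro distribution_scale T test_functions_reflect R_test)
    also have "(\<lambda>t. R f h (x - t)) = (\<lambda>t. (f (x + h - t) + (-1) * f (x - t)) +
        (-1) * (\<Sum>i\<in>UNIV. of_real (h $ i) * partial_deriv i f (x - t)))"
      unfolding R_def by (simp add: algebra_simps)
    also have "T \<dots> = distr_convolution T f (x + h) - distr_convolution T f x - ?D h"
      unfolding distr_convolution_def
      by (subst distribution_add[OF T] distribution_scale[OF T] distribution_sum[OF T], (intro closure f)+)+
        (simp add: distribution_scale[OF T] closure f scaleR_conv_of_real)
    finally show ?thesis .
  qed
  obtain r where r: "\<And>y. r < norm y \<Longrightarrow> f y = 0"
    using test_function_supportE[OF f] by blast
  show "((\<lambda>h. norm (distr_convolution T f (x + h) - distr_convolution T f x - ?D h) / norm h) \<longlongrightarrow> 0) (at 0)"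
    unfolding tendsto_at_iff_sequentially
  proof (intro allI impI)
    fix X :: "nat \<Rightarrow> real ^ 'n"
    assume X: "X \<longlonglongrightarrow> 0"
    then obtain B where B: "\<And>k. norm (X k) \<le> B"
      by (meson BseqE convergentI convergent_imp_Bseq)
    have "test_function_limit (\<lambda>k t. q (X k) (x - t)) (\<lambda>t. 0)"
    proof (rule test_function_limitI)
      fix k and t :: "real ^ 'n" assume t: "r + B + norm x < norm t"
      have "norm t \<le> norm (x - t) + norm x"
        by (metis norm_minus_commute norm_triangle_sub add.commute)
      moreover have "norm (x - t) \<le> norm (x - t + X k) + norm (X k)"
        by (metis add_diff_cancel_right' norm_triangle_ineq4)
      moreover have "norm (X k) \<le> B" "0 \<le> norm (X k)" using B by auto
      ultimately have "r < norm (x - t)" "r < norm (x - t + X k)"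
        using t by linarith+
      then show "q (X k) (x - t) = 0"
        using partial_deriv_vanishing[of r f "x - t"] r by (simp add: q_def R_def)
    next
      fix "is" :: "'n list"
      show "uniform_limit UNIV (\<lambda>k. partial_derivs is (\<lambda>t. q (X k) (x - t))) (partial_derivs is (\<lambda>t. 0)) sequentially"
      proof (rule uniform_limitI)
        fix e :: real assume "e > 0"
        then have "e / 2 > 0" by simp
        from q_small[OF this, of "is"] obtain d where d: "d > 0" "\<And>h y. norm h < d \<Longrightarrow> norm (partial_derivs is (q h) y) \<le> e / 2"
          by blast
        have "\<forall>\<^sub>F k in sequentially. norm (X k) < d"
          using tendstoD[OF X d(1)] by simp
        then show "\<forall>\<^sub>F k in sequentially. \<forall>t\<in>UNIV. dist (partial_derivs is (\<lambda>t. q (X k) (x - t)) t)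
            (partial_derivs is (\<lambda>t. 0) t) < e"
        proof eventually_elim
          case (elim k)
          have "norm (partial_derivs is (q (X k)) y) < e" for y
            using d(2)[OF elim, of y] \<open>e > 0\<close> by simp
          then show ?case
            by (simp add: partial_derivs_reflect test_functions_smooth q_test partial_derivs_zero norm_mult norm_power)
        qed
      qed
    qed (auto intro: test_functions_reflect q_test test_functions_zero)
    from distribution_tendsto[OF T this]
    have "(\<lambda>k. norm (T (\<lambda>t. q (X k) (x - t)))) \<longlonglongrightarrow> 0"
      using distribution_zero[OF T] tendsto_norm_zero by metis
    then show "((\<lambda>h. norm (distr_convolution T f (x + h) - distr_convolution T f x - ?D h) / norm h) \<circ> X) \<longlonglongrightarrow> 0"
      by (simp add: Tq norm_mult o_def divide_inverse mult.commute norm_inverse)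
  qed
qed

lemma partial_derivs_distr_convolution:
  assumes T: "T \<in> distributions" and f: "f \<in> test_functions"
  shows "partial_derivs is (distr_convolution T f) = distr_convolution T (partial_derivs is f)"
proof (induction "is")
  case (Cons i "is")
  let ?f = "partial_derivs is f"
  have "partial_deriv i (distr_convolution T ?f) x = distr_convolution T (partial_deriv i ?f) x" for x
  proof -
    have "partial_deriv i (distr_convolution T ?f) x =
        (\<Sum>j\<in>UNIV. (axis i 1 $ j) *\<^sub>R distr_convolution T (partial_deriv j ?f) x)"
      by (intro partial_deriv_unique distr_convolution_has_derivative T test_functions_partial_derivs f)
    also have "\<dots> = (\<Sum>j\<in>UNIV. if j = i then distr_convolution T (partial_deriv i ?f) x else 0)"
      by (intro sum.cong) (auto simp: axis_def)
    finally show ?thesis by simp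
  qed
  with Cons show ?case by auto
qed auto

lemma distr_convolution_smooth:
  assumes T: "T \<in> distributions" and f: "f \<in> test_functions"
  shows "distr_convolution T f \<in> smooth_functions"
proof -
  have "distr_convolution T (partial_derivs is f) differentiable (at x)" for "is" x
    using distr_convolution_has_derivative[OF T test_functions_partial_derivs[OF f]]
    unfolding differentiable_def by blast
  then show ?thesis
    by (simp add: smooth_functions_def partial_derivs_distr_convolution[OF T f])
qed

section \<open>Convolution of test functions\<close>

text \<open>
  The distribution with density \<open>g\<close>. It lets the convolution of two functions be written as
  \<^term>\<open>distr_convolution (regular_distribution g) f\<close>, so that smoothness and the rule for its derivatives
  are instances of the facts about distributions.
\<close>

definition regular_distribution :: "(real ^ 'n \<Rightarrow> complex) \<Rightarrow> (real ^ 'n \<Rightarrow> complex) \<Rightarrow> complex"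
  where "regular_distribution g = (\<lambda>f\<in>test_functions. LINT x|lborel. g x * f x)"

lemma regular_distribution_in_distributions:
  fixes g :: "real ^ 'n \<Rightarrow> complex"
  assumes g: "g \<in> test_functions"
  shows "regular_distribution g \<in> distributions"
proof -
  have int: "integrable lborel (\<lambda>x. g x * f x)" if "f \<in> test_functions" for f :: "real ^ 'n \<Rightarrow> complex"
    using that by (intro integrable_test_function_mult g test_functions_continuous_on)
  have lim: "(\<lambda>k. regular_distribution g (fs k)) \<longlonglongrightarrow> regular_distribution g f"
    if "test_function_limit fs f" for fs f
  proof (rule tendstoI)
    fix e :: real assume e: "e > 0"
    have fs: "fs k \<in> test_functions" and f: "f \<in> test_functions" for k
      using that by (auto simp: test_function_limit_def)
    have unif: "uniform_limit UNIV fs f sequentially"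
      using that unfolding test_function_limit_def by (auto dest: spec[of _ "[]"])
    define M where "M = (LINT x|lborel. norm (g x))"
    have M: "0 \<le> M" by (simp add: M_def)
    have "0 < e / (M + 1)" using e M by simp
    from uniform_limitD[OF unif this]
    show "\<forall>\<^sub>F k in sequentially. dist (regular_distribution g (fs k)) (regular_distribution g f) < e"
    proof eventually_elim
      case (elim k)
      have int': "integrable lborel (\<lambda>x. g x * fs k x - g x * f x)"
        by (intro Bochner_Integration.integrable_diff int fs f)
      have "dist (regular_distribution g (fs k)) (regular_distribution g f) =
          norm (LINT x|lborel. g x * fs k x - g x * f x)"
        using fs f by (simp add: regular_distribution_def dist_norm int)
      also have "\<dots> \<le> (LINT x|lborel. norm (g x * fs k x - g x * f x))"
        by (rule integral_norm_bound)
      also have "\<dots> \<le> (LINT x|lborel. norm (g x) * (e / (M + 1)))"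
      proof (rule integral_mono)
        fix x
        have "norm (g x * fs k x - g x * f x) = norm (g x) * norm (fs k x - f x)"
          by (simp add: norm_mult flip: right_diff_distrib)
        also have "\<dots> \<le> norm (g x) * (e / (M + 1))"
          using elim by (intro mult_left_mono) (auto simp: dist_norm intro: less_imp_le)
        finally show "norm (g x * fs k x - g x * f x) \<le> norm (g x) * (e / (M + 1))" .
      qed (intro integrable_norm integrable_mult_left integrable_test_function int' g)+
      also have "\<dots> = M * (e / (M + 1))"
        by (simp add: M_def)
      also have "\<dots> < e"
        using e M by (simp add: field_simps)
      finally show ?case .
    qed
  qed
  show ?thesis
    unfolding distributions_def
  proof (intro CollectI conjI allI ballI impI lim)
    show "regular_distribution g \<in> extensional test_functions"
      by (simp add: regular_distribution_def)
    fix f h :: "real ^ 'n \<Rightarrow> complex" assume f: "f \<in> test_functions" and h: "h \<in> test_functions"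
    then show "regular_distribution g (\<lambda>x. f x + h x) = regular_distribution g f + regular_distribution g h"
      by (simp add: regular_distribution_def test_functions_add ring_distribs int)
  next
    fix c and f :: "real ^ 'n \<Rightarrow> complex" assume f: "f \<in> test_functions"
    have "(LINT x|lborel. g x * (c * f x)) = c * (LINT x|lborel. g x * f x)"
      by (simp add: mult.left_commute)
    then show "regular_distribution g (\<lambda>x. c * f x) = c * regular_distribution g f"
      using f by (simp add: regular_distribution_def test_functions_scale)
  qed
qed

lemma distr_convolution_regular:
  "f \<in> test_functions \<Longrightarrow>
    distr_convolution (regular_distribution g) f t = (LINT x|lborel. g x * f (t - x))"
  by (simp add: distr_convolution_def regular_distribution_def test_functions_reflect)

text \<open>
  Combined with \<open>partial_derivs_distr_convolution\<close> this allows the derivatives of a convolution to be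
  moved to either factor.
\<close>

lemma distr_convolution_regular_commute:
  assumes f: "f \<in> test_functions" and g: "g \<in> test_functions"
  shows "distr_convolution (regular_distribution g) f = distr_convolution (regular_distribution f) g"
proof
  fix t :: "real ^ 'a"
  have "continuous_on UNIV f" "continuous_on UNIV g"
    using f g by (auto intro: test_functions_continuous_on)
  then have [measurable]: "f \<in> borel_measurable borel" "g \<in> borel_measurable borel"
    by (auto intro: borel_measurable_continuous_onI)
  have "lborel = distr lborel borel (\<lambda>x. t - x)"
    using lborel_affine[of "-1" t] by (simp add: density_1)
  then have "(LINT x|lborel. g x * f (t - x)) = (LINT x|distr lborel borel (\<lambda>x. t - x). g x * f (t - x))"
    by simp
  also have "\<dots> = (LINT x|lborel. g (t - x) * f x)"
    by (subst integral_distr) auto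
  finally show "distr_convolution (regular_distribution g) f t = distr_convolution (regular_distribution f) g t"
    using f g by (simp add: distr_convolution_regular mult.commute)
qed

lemma distr_convolution_regular_vanishing:
  assumes f: "f \<in> test_functions"
    and "\<And>x. r < norm x \<Longrightarrow> f x = 0" "\<And>x. s < norm x \<Longrightarrow> g x = 0" "s + r < norm t"
  shows "distr_convolution (regular_distribution g) f t = 0"
proof -
  have "g x * f (t - x) = 0" for x
  proof (cases "s < norm x")
    case False
    then have "r < norm (t - x)"
      using assms(4) norm_triangle_sub[of t x] by linarith
    then show ?thesis using assms(2) by simp
  qed (use assms(3) in simp)
  then show ?thesis
    by (simp only: distr_convolution_regular[OF f] integral_zero)
qed

lemma distr_convolution_regular_test_function:
  assumes f: "f \<in> test_functions" and g: "g \<in> test_functions"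
  shows "distr_convolution (regular_distribution g) f \<in> test_functions"
proof -
  obtain r s where rs: "\<And>x. r < norm x \<Longrightarrow> f x = 0" "\<And>x. s < norm x \<Longrightarrow> g x = 0"
    using f g by (metis test_function_supportE)
  have "\<forall>t. s + r < norm t \<longrightarrow> distr_convolution (regular_distribution g) f t = 0"
    using distr_convolution_regular_vanishing[OF f, of r s g] rs by blast
  then show ?thesis
    unfolding test_functions_iff
    using distr_convolution_smooth[OF regular_distribution_in_distributions[OF g] f] by blast
qed

section \<open>Riemann sums of a convolution\<close>

lemma test_function_bounded:
  assumes f: "f \<in> test_functions"
  obtains M where "0 < M" "\<And>x. norm (f x) \<le> M"
proof -
  obtain r where r: "\<And>x. r < norm x \<Longrightarrow> f x = 0"
    using test_function_supportE[OF f] by blast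
  have "bounded (f ` cball 0 r)"
    by (intro compact_imp_bounded compact_continuous_image test_functions_continuous_on f) auto
  then obtain M where M: "M > 0" "\<forall>x\<in>cball 0 r. norm (f x) \<le> M"
    by (auto simp: bounded_pos)
  have "norm (f x) \<le> M" for x
    using M r[of x] by (cases "r < norm x") auto
  with M(1) show ?thesis by (rule that)
qed

text \<open>
  For fixed \<open>t\<close> these are Riemann sums of \<open>x \<mapsto> g x * f (t - x)\<close>. The oscillation of this integrand
  over small balls is bounded independently of \<open>t\<close>, because \<open>f\<close> and \<open>g\<close> are bounded and uniformly
  continuous; therefore the convergence is uniform in \<open>t\<close>. The divisions are allowed to be arbitrary
  as long as they get fine, so that one sequence of divisions works for all derivatives of \<open>f\<close>.
\<close>

lemma Riemann_sums_uniform_limit: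
  fixes f g :: "real ^ 'n \<Rightarrow> complex"
  assumes f: "f \<in> test_functions" and g: "g \<in> test_functions"
    and supp: "\<And>x. x \<notin> cbox a b \<Longrightarrow> g x = 0"
    and p: "\<And>k. p k tagged_division_of (cbox a b)"
    and fine: "\<And>k. (\<lambda>x. ball x (inverse (real (Suc k)))) fine p k"
  shows "uniform_limit UNIV (\<lambda>k t. \<Sum>(x, K)\<in>p k. of_real (measure lborel K) * g x * f (t - x))
    (distr_convolution (regular_distribution g) f) sequentially"
proof (rule uniform_limitI)
  fix e :: real assume e: "e > 0"
  define C where "C = measure lborel (cbox a b)"
  \<comment> \<open>The box may be degenerate, hence the summand \<open>1\<close>; \<open>e'\<close> is the oscillation allowed per cell.\<close>
  define e' where "e' = e / (C + 1)"
  have C: "C \<ge> 0" by (simp add: C_def)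
  then have e': "e' > 0" "e' * C < e" using e by (auto simp: e'_def field_simps)
  obtain Mf where Mf: "0 < Mf" "\<And>x. norm (f x) \<le> Mf" using test_function_bounded[OF f] by blast
  obtain Mg where Mg: "0 < Mg" "\<And>x. norm (g x) \<le> Mg" using test_function_bounded[OF g] by blast
  define e'' where "e'' = e' / (Mf + Mg)"
  have e'': "e'' > 0" using e' Mf Mg by (simp add: e''_def)
  obtain df where df: "df > 0" "\<And>x y. norm (y - x) < df \<Longrightarrow> norm (f y - f x) < e''"
    using test_function_uniformly_continuous[OF f e''] by blast
  obtain dg where dg: "dg > 0" "\<And>x y. norm (y - x) < dg \<Longrightarrow> norm (g y - g x) < e''"
    using test_function_uniformly_continuous[OF g e''] by blast
  have "\<forall>\<^sub>F k in sequentially. inverse (real (Suc k)) < min df dg"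
    using df dg by (intro order_tendstoD(2)[OF LIMSEQ_inverse_real_of_nat]) auto
  then show "\<forall>\<^sub>F k in sequentially. \<forall>t\<in>UNIV. dist (\<Sum>(x, K)\<in>p k. of_real (measure lborel K) * g x * f (t - x))
      (distr_convolution (regular_distribution g) f t) < e"
  proof eventually_elim
    case (elim k)
    show ?case
    proof
      fix t :: "real ^ 'n"
      define G where "G = (\<lambda>x. g x * f (t - x))"
      have osc: "norm (G x - G y) \<le> e'" if xy: "dist x y < inverse (real (Suc k))" for x y
      proof -
        have "norm (g x - g y) < e''"
          using elim xy by (intro dg(2)) (simp add: dist_norm)
        moreover have "norm (f (t - x) - f (t - y)) < e''"
          using elim xy by (intro df(2)) (simp add: dist_norm norm_minus_commute)
        moreover have "G x - G y = (g x - g y) * f (t - x) + g y * (f (t - x) - f (t - y))"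
          by (simp add: G_def algebra_simps)
        ultimately have "norm (G x - G y) \<le> e'' * Mf + Mg * e''"
          using Mf Mg e''
          by (simp only:, intro norm_triangle_le add_mono)
            (simp_all only: norm_mult, (intro mult_mono less_imp_le[of _ e'']; simp)+)
        also have "\<dots> = e'' * (Mf + Mg)" by (simp add: ring_distribs mult.commute)
        also have "\<dots> = e'" using Mf(1) Mg(1) by (simp add: e''_def)
        finally show ?thesis .
      qed
      have contG: "continuous_on A G" for A
        unfolding G_def using g test_functions_reflect[OF f, of t]
        by (intro continuous_on_mult test_functions_continuous_on)
      have "integrable lborel G"
        unfolding G_def
        by (intro integrable_test_function_mult g test_functions_continuous_on test_functions_reflect f)
      then have "(G has_integral (LINT x|lborel. G x)) UNIV"
        by (rule has_integral_integral_lborel)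
      moreover have "(\<lambda>x. if x \<in> cbox a b then G x else 0) = G"
        using supp by (auto simp: G_def)
      ultimately have "(G has_integral (LINT x|lborel. G x)) (cbox a b)"
        using has_integral_restrict_UNIV[of "cbox a b" G "LINT x|lborel. G x"] by metis
      then have conv: "distr_convolution (regular_distribution g) f t = integral (cbox a b) G"
        using f by (simp add: distr_convolution_regular G_def integral_unique)
      also have "\<dots> = (\<Sum>(x, K)\<in>p k. integral K G)"
        by (intro integral_combine_tagged_division_topdown p integrable_continuous contG)
      finally have "dist (\<Sum>(x, K)\<in>p k. of_real (measure lborel K) * g x * f (t - x))
          (distr_convolution (regular_distribution g) f t) =
          norm (\<Sum>(x, K)\<in>p k. measure lborel K *\<^sub>R G x - integral K G)"
        by (simp add: dist_norm sum_subtractf split_def G_def scaleR_conv_of_real mult.assoc)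
      also have "\<dots> \<le> (\<Sum>(x, K)\<in>p k. e' * measure lborel K)"
      proof (rule sum_norm_le, clarify)
        fix x K assume xK: "(x, K) \<in> p k"
        then obtain u v where K: "K = cbox u v"
          using tagged_division_ofD(4)[OF p] by blast
        have "G integrable_on K" unfolding K by (intro integrable_continuous contG)
        then have "((\<lambda>y. G x - G y) has_integral measure lborel K *\<^sub>R G x - integral K G) (cbox u v)"
          unfolding K by (intro has_integral_diff has_integral_const integrable_integral)
        moreover have "K \<subseteq> ball x (inverse (real (Suc k)))"
          using fineD[OF fine xK] .
        then have "norm (G x - G y) \<le> e'" if "y \<in> cbox u v" for y
          using that by (intro osc) (auto simp: K)
        ultimately show "norm (measure lborel K *\<^sub>R G x - integral K G) \<le> e' * measure lborel K"
          unfolding K using e' by (intro has_integral_bound) auto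
      qed
      also have "\<dots> = e' * C"
        using additive_content_tagged_division[OF p[of k]]
        by (simp add: C_def split_def flip: sum_distrib_left)
      also have "\<dots> < e" by (rule e')
      finally show "dist (\<Sum>(x, K)\<in>p k. of_real (measure lborel K) * g x * f (t - x))
          (distr_convolution (regular_distribution g) f t) < e" .
    qed
  qed
qed

text \<open>
  A convolution is a limit in \<open>\<D>(\<real>\<^sup>d)\<close> of finite linear combinations of translates of \<open>f\<close>. This stands
  in for interchanging a distribution with an integral: a distribution need only be known on the
  translates.
\<close>

lemma convolution_limit_of_Riemann_sums:
  fixes f g :: "real ^ 'n \<Rightarrow> complex"
  assumes f: "f \<in> test_functions" and g: "g \<in> test_functions"
  obtains p :: "nat \<Rightarrow> ((real ^ 'n) \<times> (real ^ 'n) set) set"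
  where "test_function_limit (\<lambda>k t. \<Sum>(x, K)\<in>p k. of_real (measure lborel K) * g x * f (t - x))
    (distr_convolution (regular_distribution g) f)"
proof -
  obtain r where r: "\<And>x. r < norm x \<Longrightarrow> f x = 0"
    using test_function_supportE[OF f] by blast
  obtain s where s: "\<And>x. s < norm x \<Longrightarrow> g x = 0"
    using test_function_supportE[OF g] by blast
  obtain a b where ab: "cball 0 s \<subseteq> cbox a (b :: real ^ 'n)"
    using bounded_subset_cbox_symmetric[OF bounded_cball] by metis
  have "\<exists>p. p tagged_division_of (cbox a b) \<and> (\<lambda>x. ball x (inverse (real (Suc k)))) fine p" for k
    by (rule fine_division_exists[of "\<lambda>x. ball x (inverse (real (Suc k)))" a b]) (auto simp: gauge_def)
  then obtain p where p: "\<And>k. p k tagged_division_of (cbox a b)"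
    "\<And>k. (\<lambda>x. ball x (inverse (real (Suc k)))) fine p k"
    by metis
  have supp: "g x = 0" if "x \<notin> cbox a b" for x
  proof (rule s)
    show "s < norm x"
      using that ab by (auto simp: subset_iff not_le[symmetric])
  qed
  have shift: "(\<lambda>t. c * f (t - x)) \<in> test_functions" for c x
    using test_functions_scale[OF test_functions_translate[OF f, of "- x"]] by simp
  have shift_deriv: "partial_derivs is (\<lambda>t. c * f (t - x)) = (\<lambda>t. c * partial_derivs is f (t - x))" for "is" c x
    using f test_functions_translate[OF f, of "- x"] partial_derivs_translate[of f "is" "- x"]
    by (simp add: partial_derivs_scale test_functions_smooth)
  have "test_function_limit (\<lambda>k t. \<Sum>(x, K)\<in>p k. of_real (measure lborel K) * g x * f (t - x))
    (distr_convolution (regular_distribution g) f)"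
  proof (rule test_function_limitI)
    show "(\<lambda>t. \<Sum>(x, K)\<in>p k. of_real (measure lborel K) * g x * f (t - x)) \<in> test_functions" for k
      unfolding split_def by (intro test_functions_sum shift)
    show "distr_convolution (regular_distribution g) f \<in> test_functions"
      by (rule distr_convolution_regular_test_function[OF f g])
    fix t :: "real ^ 'n" assume t: "s + r < norm t"
    show "distr_convolution (regular_distribution g) f t = 0"
      using distr_convolution_regular_vanishing[OF f r s t] .
    have "g x * f (t - x) = 0" for x
      using r[of "t - x"] s[of x] t norm_triangle_sub[of t x] by (cases "s < norm x") auto
    then show "(\<Sum>(x, K)\<in>p k. of_real (measure lborel K) * g x * f (t - x)) = 0" for k
      by (intro sum.neutral) (auto simp: mult.assoc)
  next
    fix "is" :: "'n list"
    have "partial_derivs is (\<lambda>t. \<Sum>(x, K)\<in>p k. of_real (measure lborel K) * g x * f (t - x)) =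
        (\<lambda>t. \<Sum>(x, K)\<in>p k. of_real (measure lborel K) * g x * partial_derivs is f (t - x))" for k
      unfolding split_def by (subst partial_derivs_sum) (auto simp: shift_deriv intro: shift test_functions_smooth)
    moreover have "partial_derivs is (distr_convolution (regular_distribution g) f) =
        distr_convolution (regular_distribution g) (partial_derivs is f)"
      by (intro partial_derivs_distr_convolution regular_distribution_in_distributions f g)
    ultimately show "uniform_limit UNIV
        (\<lambda>k. partial_derivs is (\<lambda>t. \<Sum>(x, K)\<in>p k. of_real (measure lborel K) * g x * f (t - x)))
        (partial_derivs is (distr_convolution (regular_distribution g) f)) sequentially"
      using Riemann_sums_uniform_limit[OF test_functions_partial_derivs[OF f] g supp p] by simp
  qed
  then show ?thesis by (rule that)
qed

section \<open>Approximate identities\<close>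

text \<open>
  Differentiation can be moved to \<open>f\<close>, and
  \<open>(\<phi>\<^sub>n * \<partial>\<^sup>\<alpha> f)(t) - \<partial>\<^sup>\<alpha> f(t) = \<integral> \<phi>\<^sub>n(x) (\<partial>\<^sup>\<alpha> f(t - x) - \<partial>\<^sup>\<alpha> f(t)) dx\<close> is at most \<open>M\<close> times the oscillation
  of \<open>\<partial>\<^sup>\<alpha> f\<close> at the scale of the support of \<open>\<phi>\<^sub>n\<close>.
\<close>

lemma approximate_identity_limit:
  fixes f :: "real ^ 'n \<Rightarrow> complex"
  assumes f: "f \<in> test_functions" and \<phi>: "\<And>n. \<phi> n \<in> test_functions"
    and supp: "\<And>n x. inverse (real (Suc n)) \<le> norm x \<Longrightarrow> \<phi> n x = 0"
    and int1: "\<And>n. (LINT x|lborel. \<phi> n x) = 1"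
    and L1: "\<And>n. (LINT x|lborel. norm (\<phi> n x)) \<le> M"
  shows "test_function_limit (\<lambda>n. distr_convolution (regular_distribution (\<phi> n)) f) f"
proof -
  obtain r where r: "\<And>x. r < norm x \<Longrightarrow> f x = 0"
    using test_function_supportE[OF f] by blast
  have supp1: "\<phi> n x = 0" if "1 < norm x" for n x
  proof (rule supp)
    have "inverse (real (Suc n)) \<le> 1" by (simp add: inverse_le_1_iff)
    with that show "inverse (real (Suc n)) \<le> norm x" by linarith
  qed
  show ?thesis
  proof (rule test_function_limitI)
    show "distr_convolution (regular_distribution (\<phi> n)) f \<in> test_functions" for n
      by (rule distr_convolution_regular_test_function[OF f \<phi>])
    fix t :: "real ^ 'n" assume t: "1 + r < norm t"
    show "distr_convolution (regular_distribution (\<phi> n)) f t = 0" for n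
      using distr_convolution_regular_vanishing[OF f r supp1 t] .
    show "f t = 0" using norm_ge_zero r t by simp
  next
    fix "is" :: "'n list"
    let ?f = "partial_derivs is f"
    have f': "?f \<in> test_functions" by (rule test_functions_partial_derivs[OF f])
    have "0 \<le> (LINT x|lborel. norm (\<phi> 0 x))" by simp
    also have "\<dots> \<le> M" by (rule L1)
    finally have "M \<ge> 0" .
    have "uniform_limit UNIV (\<lambda>n. distr_convolution (regular_distribution (\<phi> n)) ?f) ?f sequentially"
    proof (rule uniform_limitI)
      fix e :: real assume e: "e > 0"
      define e' where "e' = e / (M + 1)"
      have e': "e' > 0" "M * e' < e" using e \<open>M \<ge> 0\<close> by (auto simp: e'_def field_simps)
      obtain d where d: "d > 0" "\<And>x y. norm (y - x) < d \<Longrightarrow> norm (?f y - ?f x) < e'"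
        using test_function_uniformly_continuous[OF f' e'(1)] by blast
      have "\<forall>\<^sub>F n in sequentially. inverse (real (Suc n)) < d"
        using LIMSEQ_inverse_real_of_nat d(1) by (rule order_tendstoD)
      then show "\<forall>\<^sub>F n in sequentially. \<forall>t\<in>UNIV.
          dist (distr_convolution (regular_distribution (\<phi> n)) ?f t) (?f t) < e"
      proof eventually_elim
        case (elim n)
        show ?case
        proof
          fix t :: "real ^ 'n"
          have int: "integrable lborel (\<lambda>x. \<phi> n x * ?f (t - x))"
            by (intro integrable_test_function_mult \<phi> test_functions_continuous_on test_functions_reflect f')
          have int': "integrable lborel (\<lambda>x. \<phi> n x * ?f t)"
            by (intro integrable_mult_left integrable_test_function \<phi>)
          have "?f t = (LINT x|lborel. \<phi> n x * ?f t)"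
            by (simp add: int1)
          then have "dist (distr_convolution (regular_distribution (\<phi> n)) ?f t) (?f t) =
              norm (LINT x|lborel. \<phi> n x * ?f (t - x) - \<phi> n x * ?f t)"
            unfolding dist_norm distr_convolution_regular[OF f'] Bochner_Integration.integral_diff[OF int int']
            by (simp only:)
          also have "\<dots> \<le> (LINT x|lborel. norm (\<phi> n x * ?f (t - x) - \<phi> n x * ?f t))"
            by (rule integral_norm_bound)
          also have "\<dots> \<le> (LINT x|lborel. norm (\<phi> n x) * e')"
          proof (rule integral_mono)
            show "integrable lborel (\<lambda>x. norm (\<phi> n x * ?f (t - x) - \<phi> n x * ?f t))"
              by (intro integrable_norm Bochner_Integration.integrable_diff int int')
            show "integrable lborel (\<lambda>x. norm (\<phi> n x) * e')"
              by (intro integrable_mult_left integrable_norm integrable_test_function \<phi>)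
            fix x
            show "norm (\<phi> n x * ?f (t - x) - \<phi> n x * ?f t) \<le> norm (\<phi> n x) * e'"
            proof (cases "inverse (real (Suc n)) \<le> norm x")
              case False
              then have "norm (t - x - t) < d" using elim by simp
              from d(2)[OF this] have "norm (\<phi> n x) * norm (?f (t - x) - ?f t) \<le> norm (\<phi> n x) * e'"
                by (intro mult_left_mono) auto
              then show ?thesis
                by (simp add: norm_mult flip: right_diff_distrib)
            qed (simp add: supp)
          qed
          also have "\<dots> = (LINT x|lborel. norm (\<phi> n x)) * e'"
            by simp
          also have "\<dots> \<le> M * e'"
            using e'(1) by (intro mult_right_mono L1) auto
          also have "\<dots> < e" by (rule e')
          finally show "dist (distr_convolution (regular_distribution (\<phi> n)) ?f t) (?f t) < e" .
        qed
      qed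
    qed
    then show "uniform_limit UNIV (\<lambda>n. partial_derivs is (distr_convolution (regular_distribution (\<phi> n)) f))
        (partial_derivs is f) sequentially"
      by (simp add: partial_derivs_distr_convolution regular_distribution_in_distributions \<phi> f)
  qed (fact f)
qed

section \<open>The embedding\<close>

text \<open>
  By symmetry of \<open>\<phi>\<close> the value of a distribution at the translate \<open>t \<mapsto> \<phi>(t - x)\<close> is its convolution
  with \<open>\<phi>\<close> at \<open>x\<close>. So \<open>T\<close> and \<open>S\<close> have the same values at the Riemann sums of \<open>g * \<phi>\<close>, and by
  continuity at \<open>g * \<phi>\<close> itself.
\<close>

lemma distributions_agree_on_convolution:
  assumes T: "T \<in> distributions" and S: "S \<in> distributions"
    and \<phi>: "\<phi> \<in> test_functions" "\<And>x. \<phi> (- x) = \<phi> x"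
    and eq: "distr_convolution T \<phi> = distr_convolution S \<phi>" and g: "g \<in> test_functions"
  shows "T (distr_convolution (regular_distribution g) \<phi>) = S (distr_convolution (regular_distribution g) \<phi>)"
proof -
  obtain p :: "nat \<Rightarrow> ((real ^ 'a) \<times> (real ^ 'a) set) set" where
    p: "test_function_limit (\<lambda>k t. \<Sum>(x, K)\<in>p k. of_real (measure lborel K) * g x * \<phi> (t - x))
      (distr_convolution (regular_distribution g) \<phi>)"
    using convolution_limit_of_Riemann_sums[OF \<phi>(1) g] by blast
  have shift: "(\<lambda>t. c * \<phi> (t - x)) = (\<lambda>t. c * \<phi> (x - t))" for c x
    using \<phi>(2) by (metis minus_diff_eq)
  have R: "R (\<lambda>t. \<Sum>(x, K)\<in>p k. of_real (measure lborel K) * g x * \<phi> (t - x)) =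
      (\<Sum>(x, K)\<in>p k. of_real (measure lborel K) * g x * distr_convolution R \<phi> x)"
    if "R \<in> distributions" for R k
    unfolding split_def
    by (subst distribution_sum[OF that])
      (simp_all only: shift distribution_scale[OF that] distr_convolution_def
        test_functions_scale test_functions_reflect \<phi>(1))
  show ?thesis
    using distribution_tendsto[OF T p] distribution_tendsto[OF S p]
    unfolding R[OF T] R[OF S] eq by (rule LIMSEQ_unique)
qed

lemma directing_setD:
  assumes "\<phi> \<in> directing_set n" "1 \<le> n"
  shows "\<phi> \<in> test_functions" "\<phi> (- x) = \<phi> x" "1 / real n \<le> norm x \<Longrightarrow> \<phi> x = 0"
    "(LINT x|lborel. \<phi> x) = 1" "(LINT x|lborel. norm (\<phi> x)) < 1 + 1 / real n"
proof -
  have "n \<noteq> 0" using assms(2) by simp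
  note D = assms(1)[unfolded directing_set_def if_not_P[OF this] mem_Collect_eq]
  from D show "\<phi> \<in> test_functions" by (elim conjE)
  from D show "\<phi> (- x) = \<phi> x" by (elim conjE allE)
  from D show "1 / real n \<le> norm x \<Longrightarrow> \<phi> x = 0" by (elim conjE) blast
  from D show "(LINT x|lborel. \<phi> x) = 1" by (elim conjE)
  from D show "(LINT x|lborel. norm (\<phi> x)) < 1 + 1 / real n" by (elim conjE)
qed

text \<open>
  One element \<open>\<phi>\<^sub>n\<close> of each directing set is enough: these elements form an approximate identity, and
  \<open>T\<close> and \<open>S\<close> have the same values at every \<open>\<phi>\<^sub>n * f\<close>.
\<close>

lemma distributions_eq_if_convolutions_eq:
  assumes T: "T \<in> distributions" and S: "S \<in> distributions"
    and ex: "\<And>n. 1 \<le> n \<Longrightarrow> \<exists>\<phi>\<in>directing_set n. distr_convolution T \<phi> = distr_convolution S \<phi>"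
  shows "T = S"
proof (rule extensionalityI)
  show "T \<in> extensional test_functions" "S \<in> extensional test_functions"
    using T S by (auto simp: distributions_def)
  fix f :: "real ^ 'a \<Rightarrow> complex" assume f: "f \<in> test_functions"
  have "\<forall>n. \<exists>\<phi>. \<phi> \<in> directing_set (Suc n) \<and> distr_convolution T \<phi> = distr_convolution S \<phi>"
    using ex by (simp add: Bex_def)
  then obtain \<phi> where \<phi>: "\<And>n. \<phi> n \<in> directing_set (Suc n)"
    and eq: "\<And>n. distr_convolution T (\<phi> n) = distr_convolution S (\<phi> n)"
    by (auto dest!: choice)
  note D = directing_setD[OF \<phi>]
  have test: "\<phi> n \<in> test_functions" for n
    by (rule D) simp
  have sym: "\<phi> n (- x) = \<phi> n x" for n x
    by (rule D) simp
  have lim: "test_function_limit (\<lambda>n. distr_convolution (regular_distribution (\<phi> n)) f) f"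
  proof (rule approximate_identity_limit[OF f test])
    show "\<phi> n x = 0" if "inverse (real (Suc n)) \<le> norm x" for n x
      using that by (intro D(3)) (simp_all add: inverse_eq_divide)
    show "(LINT x|lborel. \<phi> n x) = 1" for n
      by (rule D) simp
    show "(LINT x|lborel. norm (\<phi> n x)) \<le> 2" for n
    proof -
      have "(LINT x|lborel. norm (\<phi> n x)) < 1 + 1 / real (Suc n)"
        by (rule D) simp
      also have "\<dots> \<le> 2" by simp
      finally show ?thesis by simp
    qed
  qed
  have agree: "T (distr_convolution (regular_distribution (\<phi> n)) f) =
      S (distr_convolution (regular_distribution (\<phi> n)) f)" for n
    unfolding distr_convolution_regular_commute[OF f test]
    by (rule distributions_agree_on_convolution[OF T S test sym eq f])
  show "T f = S f"
    using distribution_tendsto[OF T lim] distribution_tendsto[OF S lim] unfolding agree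
    by (rule LIMSEQ_unique)
qed

lemma convolution_family_smooth:
  "T \<in> distributions \<Longrightarrow> restrict (distr_convolution T) test_functions \<in> smooth_families"
  unfolding smooth_families_def by (intro restrict_PiE_iff[THEN iffD2] ballI distr_convolution_smooth)

theorem lemma12p1:
  fixes U :: "(real ^ 'n \<Rightarrow> complex) filter"
  assumes "ultrafilter_on test_functions U"
    and "\<forall>\<Phi>\<in>basic_filter_sets. eventually (\<lambda>\<phi>. \<phi> \<in> \<Phi>) U"
  shows "distr_embedding U \<in> distributions \<rightarrow> star_smooth U \<and>
    inj_on (distr_embedding U) distributions"
proof
  show "distr_embedding U \<in> distributions \<rightarrow> star_smooth U"
    unfolding distr_embedding_def star_class_def star_smooth_def
    by (intro funcsetI quotientI convolution_family_smooth)
  show "inj_on (distr_embedding U) distributions"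
  proof (rule inj_onI)
    fix T S :: "(real ^ 'n \<Rightarrow> complex) \<Rightarrow> complex"
    assume T: "T \<in> distributions" and S: "S \<in> distributions"
      and eq: "distr_embedding U T = distr_embedding U S"
    let ?T = "restrict (distr_convolution T) test_functions"
    let ?S = "restrict (distr_convolution S) test_functions"
    have "(?S, ?S) \<in> ae_equal U"
      using convolution_family_smooth[OF S] by (simp only: ae_equal_def) simp
    then have "?S \<in> star_class U ?S"
      by (simp only: star_class_def Image_singleton_iff)
    also have "star_class U ?S = star_class U ?T"
      using eq by (simp only: distr_embedding_def)
    finally have "(?T, ?S) \<in> ae_equal U"
      by (simp only: star_class_def Image_singleton_iff)
    then have ae: "\<forall>\<^sub>F \<phi> in U. ?T \<phi> = ?S \<phi>"
      by (simp only: ae_equal_def mem_Collect_eq case_prod_conv)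
    show "T = S"
    proof (rule distributions_eq_if_convolutions_eq[OF T S])
      fix n :: nat assume n: "1 \<le> n"
      then have test: "directing_set n \<subseteq> (test_functions :: (real ^ 'n \<Rightarrow> complex) set)"
        by (intro subsetI directing_setD(1))
      with n have "directing_set n \<in> (basic_filter_sets :: (real ^ 'n \<Rightarrow> complex) set set)"
        unfolding basic_filter_sets_def by blast
      with assms(2) have "\<forall>\<^sub>F \<phi> in U. \<phi> \<in> directing_set n"
        by (rule bspec)
      with ae have ev: "\<forall>\<^sub>F \<phi> in U. \<phi> \<in> directing_set n \<and> ?T \<phi> = ?S \<phi>"
        by eventually_elim simp
      have "U \<noteq> bot"
        using assms(1) unfolding ultrafilter_on_def by (elim conjE)
      from eventually_happens'[OF this ev] obtain \<phi> where \<phi>: "\<phi> \<in> directing_set n" "?T \<phi> = ?S \<phi>"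
        by (elim exE conjE)
      then have "\<phi> \<in> test_functions"
        using test by blast
      then have "distr_convolution T \<phi> = distr_convolution S \<phi>"
        using \<phi>(2) by simp
      with \<phi>(1) show "\<exists>\<phi>\<in>directing_set n. distr_convolution T \<phi> = distr_convolution S \<phi>"
        by blast
    qed
  qed
qed

end
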